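(* Let $\varepsilon\ge 0$ and let $U \cong \bigoplus_{j \in J} \mathbb{I}\lceil b'_j,d'_j\rfloor$ and $V \cong \bigoplus_{i \in I} \mathbb{I}\lceil b_i,d_i\rfloor$ be persistence modules of finite type indexed by $\mathbb{R}$, with $I,J$ finite and all bars nonempty. Suppose the matrix $X=\{x_{i,j}\}_{i\in I,j\in J}$ represents, in standard order, one morphism $U \to V_{\_+\varepsilon}$ of an $\varepsilon$-interleaving between $U$ and $V$. Then after ordered column (or row) reduction of $X$, the positions of the nontrivial pivots form an $\varepsilon$-matching between the barcodes of $U$ and $V$; that is, the set $M\subseteq I\times J$ of all $(i,j)$ such that the $i,j$ entry of the reduced matrix is a nontrivial pivot is an $\varepsilon$-matching between $\{\lceil b_i,d_i\rfloor\}_{i\in I}$ and $\{\lceil b'_j,d'_j\rfloor\}_{j\in J}$.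
   Context: Fix a field $F$; all vector spaces are over $F$. A persistence module $V$ indexed by $\mathbb{R}$ is a functor from the poset $\mathbb{R}$ to vector spaces, with spaces $V_t$ and structure maps $V_{s\le t}\colon V_s\to V_t$; morphisms are natural transformations; direct sums are pointwise. Decorated reals: $\mathbb{R}\times\{-,+\}$ with lexicographic order, $-<+$; write $t^\pm$, and add bottom and top elements $-\infty,\infty$. For such $b\le d$, $\lceil b,d\rfloor\subseteq\mathbb{R}$ is the interval with these endpoints: $\lceil s^-,t^+\rfloor=[s,t]$, $\lceil s^-,t^-\rfloor=[s,t)$, $\lceil s^+,t^+\rfloor=(s,t]$, $\lceil s^+,t^-\rfloor=(s,t)$, $\lceil-\infty,t^+\rfloor=(-\infty,t]$, $\lceil-\infty,t^-\rfloor=(-\infty,t)$, $\lceil s^-,\infty\rfloor=[s,\infty)$, $\lceil s^+,\infty\rfloor=(s,\infty)$, $\lceil-\infty,\infty\rfloor=\mathbb{R}$. Put $s^\pm+t=(s+t)^\pm$ and $\pm\infty+t=\pm\infty$. For an interval $L$, the interval module $\mathbb{I}(L)$ is $F$ at $t\in L$ and $0$ elsewhere, with identity structure maps inside $L$ and zero maps otherwise. A module is of finite type if it is isomorphic to a finite direct sum of interval modules; the (indexed) multiset of intervals is its barcode, and its members are bars. Interleavings: $V_{\_+\varepsilon}$ is the module with $t$ component $V_{t+\varepsilon}$ and structure maps $V_{s+\varepsilon\le t+\varepsilon}$. If $V\cong\bigoplus_{i\in I}\mathbb{I}\lceil b_i,d_i\rfloor$ then $V_{\_+\varepsilon}\cong\bigoplus_{i\in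 I}\mathbb{I}\lceil b_i-\varepsilon,d_i-\varepsilon\rfloor$, with the same index set. For $\varepsilon\ge0$, an $\varepsilon$-interleaving between $U$ and $V$ is a pair of morphisms $\varphi\colon U\to V_{\_+\varepsilon}$, $\psi\colon V\to U_{\_+\varepsilon}$ with $\psi_{t+\varepsilon}\circ\varphi_t=U_{t\le t+2\varepsilon}$ and $\varphi_{t+\varepsilon}\circ\psi_t=V_{t\le t+2\varepsilon}$ for all $t$. Matrix representation: given finite interval decompositions $A\cong\bigoplus_{j\in J}\mathbb{I}\lceil a'_j,c'_j\rfloor$ and $B\cong\bigoplus_{i\in I}\mathbb{I}\lceil a_i,c_i\rfloor$, a matrix $X=\{x_{i,j}\}$ over $F$ represents a morphism $\varphi\colon A\to B$ if $x_{i,j}=0$ whenever $a_i>a'_j$ or $c_i>c'_j$, and for all $i,j$ and all $t\in\lceil a_i,c_i\rfloor\cap\lceil a'_j,c'_j\rfloor$ the composite $\mathbb{I}\lceil a'_j,c'_j\rfloor_t\to A_t\xrightarrow{\varphi_t}B_t\to\mathbb{I}\lceil a_i,c_i\rfloor_t$ (inclusion and projection) is multiplication by $x_{i,j}$. The $i,j$ entry is trivial if $c_i\le a'_j$, and nontrivial otherwise; this terminology is also used for the reduced matrix. (So for $U\to V_{\_+\varepsilon}$ the $i,j$ entry is nontrivial iff $b'_j<d_i-\varepsilon$.) Standard order for the pair $(A,B)$: total orders on $J$ and $I$ such that $j<j'$ if $a'_j<a'_{j'}$, and $i<i'$ if $c_i>c_{i'}$ (columns ordered by birth, rows in reverse by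 death, ties arbitrary). A matrix is in standard order if its columns and rows have been given such orders. Ordered column reduction of a matrix with ordered rows and columns: process columns from least to greatest. If the current column is zero, move on. Otherwise its first (least-row) nonzero entry is its pivot; add multiples of the current column to each greater column so that the entry in the pivot's row becomes zero; then move to the next column. Ordered row reduction is the same with rows and columns interchanged. A pivot is nontrivial if it is in a nontrivial position. Matchings: a matching of barcodes $\{\lceil b_i,d_i\rfloor\}_{i\in I}$ and $\{\lceil b'_j,d'_j\rfloor\}_{j\in J}$ is a subset $M\subseteq I\times J$ in which each $i$ and each $j$ occurs at most once. It is an $\varepsilon$-matching if (1) every bar in either barcode that contains a closed interval of length $2\varepsilon$ is matched, and (2) for all $(i,j)\in M$, $\lceil b_i,d_i\rfloor\subseteq\lceil b'_j-\varepsilon,d'_j+\varepsilon\rfloor$ and $\lceil b'_j,d'_j\rfloor\subseteq\lceil b_i-\varepsilon,d_i+\varepsilon\rfloor$. *)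

theory Defs
  imports Complex_Main "HOL-Library.Function_Algebras"
begin

section \<open>Decorated reals and intervals\<close>

text \<open>The decorated real \<open>Dec t False\<close> is $t^-$ and \<open>Dec t True\<close> is $t^+$;
  the order on decorations is that of \<open>bool\<close>.\<close>

datatype dreal = NegInf | Dec real bool | PosInf

instantiation dreal :: linorder
begin

fun less_eq_dreal :: "dreal \<Rightarrow> dreal \<Rightarrow> bool" where
  "NegInf \<le> _ \<longleftrightarrow> True"
| "_ \<le> PosInf \<longleftrightarrow> True"
| "Dec s p \<le> Dec t q \<longleftrightarrow> s < t \<or> s = t \<and> p \<le> q"
| "Dec s p \<le> NegInf \<longleftrightarrow> False"
| "PosInf \<le> NegInf \<longleftrightarrow> False"
| "PosInf \<le> Dec t q \<longleftrightarrow> False"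

definition less_dreal :: "dreal \<Rightarrow> dreal \<Rightarrow> bool" where
  "less_dreal x y \<longleftrightarrow> x \<le> y \<and> \<not> y \<le> (x :: dreal)"

instance
proof
  fix x y z :: dreal
  show "x < y \<longleftrightarrow> x \<le> y \<and> \<not> y \<le> x" by (rule less_dreal_def)
  show "x \<le> x" by (cases x) auto
  show "x \<le> z" if "x \<le> y" "y \<le> z" using that by (cases x; cases y; cases z) auto
  show "x = y" if "x \<le> y" "y \<le> x" using that by (cases x; cases y) auto
  show "x \<le> y \<or> y \<le> x" by (cases x; cases y) auto
qed

end

lemma less_dreal_simps [simp]:
  "NegInf < y \<longleftrightarrow> y \<noteq> NegInf"
  "x < NegInf \<longleftrightarrow> False"
  "PosInf < y \<longleftrightarrow> False"
  "x < PosInf \<longleftrightarrow> x \<noteq> PosInf"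
  "Dec s p < Dec t q \<longleftrightarrow> s < t \<or> s = t \<and> p < q"
proof -
  show "NegInf < y \<longleftrightarrow> y \<noteq> NegInf" "x < NegInf \<longleftrightarrow> False" "PosInf < y \<longleftrightarrow> False" "x < PosInf \<longleftrightarrow> x \<noteq> PosInf"
    unfolding less_dreal_def by (cases x; cases y; simp)+
  show "Dec s p < Dec t q \<longleftrightarrow> s < t \<or> s = t \<and> p < q"
    unfolding less_dreal_def by auto
qed

fun dshift :: "dreal \<Rightarrow> real \<Rightarrow> dreal" where
  "dshift NegInf t = NegInf"
| "dshift (Dec s p) t = Dec (s + t) p"
| "dshift PosInf t = PosInf"

fun above :: "dreal \<Rightarrow> real set" where
  "above NegInf = UNIV"
| "above (Dec s False) = {s..}"
| "above (Dec s True) = {s<..}"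
| "above PosInf = {}"

fun below :: "dreal \<Rightarrow> real set" where
  "below NegInf = {}"
| "below (Dec t False) = {..<t}"
| "below (Dec t True) = {..t}"
| "below PosInf = UNIV"

text \<open>The interval with the given decorated endpoints. It is empty unless \<open>b < d\<close>, so the
  condition \<open>b \<le> d\<close> is implicit in the nonemptiness of a bar.\<close>

definition bar :: "dreal \<Rightarrow> dreal \<Rightarrow> real set" where
  "bar b d = above b \<inter> below d"

lemma mem_bar_iff: "t \<in> bar b d \<longleftrightarrow> b \<le> Dec t False \<and> Dec t True \<le> d"
proof -
  have "t \<in> above b \<longleftrightarrow> b \<le> Dec t False" by (induction b rule: above.induct) auto
  moreover have "t \<in> below d \<longleftrightarrow> Dec t True \<le> d" by (induction d rule: below.induct) auto
  ultimately show ?thesis by (simp add: bar_def)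
qed

lemma bar_nonempty_iff: "bar b d \<noteq> {} \<longleftrightarrow> b < d"
proof
  assume "bar b d \<noteq> {}"
  then obtain t where t: "b \<le> Dec t False" "Dec t True \<le> d" by (auto simp: mem_bar_iff)
  note t(1)
  also have "Dec t False < Dec t True" by simp
  also note t(2)
  finally show "b < d" .
next
  assume less: "b < d"
  have "\<exists>t. b \<le> Dec t False \<and> Dec t True \<le> d"
  proof (cases b)
    case NegInf
    then show ?thesis
      using less by (cases d) (auto, meson lt_ex)
  next
    case b: (Dec s p)
    show ?thesis
    proof (cases d)
      case (Dec u q)
      show ?thesis
      proof (cases "s < u")
        case True
        then have "s < (s + u) / 2" "(s + u) / 2 < u" by auto
        then show ?thesis using b Dec by (intro exI[of _ "(s + u) / 2"]) simp
      next
        case False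
        then show ?thesis using b Dec less by (intro exI[of _ s]) auto
      qed
    next
      case PosInf
      then show ?thesis using b by (intro exI[of _ "s + 1"]) simp
    qed (use b less in simp)
  next
    case PosInf
    then show ?thesis using less by simp
  qed
  then show "bar b d \<noteq> {}" by (auto simp: mem_bar_iff)
qed

lemma mem_bar_dshift: "t \<in> bar (dshift b e) (dshift d e) \<longleftrightarrow> t - e \<in> bar b d"
proof -
  have "dshift b e \<le> Dec t False \<longleftrightarrow> b \<le> Dec (t - e) False"
       "Dec t True \<le> dshift d e \<longleftrightarrow> Dec (t - e) True \<le> d"
    by (cases b; auto) (cases d; auto)
  then show ?thesis by (simp add: mem_bar_iff)
qed


section \<open>Persistence modules\<close>

text \<open>The spaces of a persistence module are subspaces of one ambient vector space over the
  field \<open>'f\<close>. This is no restriction up to isomorphism: the ambient space can be the direct sum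
  of all the spaces. Structure maps and components of morphisms matter only on these subspaces.\<close>

record ('f, 'v) pmod =
  scl :: "'f \<Rightarrow> 'v \<Rightarrow> 'v"
  spc :: "real \<Rightarrow> 'v set"
  smap :: "real \<Rightarrow> real \<Rightarrow> 'v \<Rightarrow> 'v"

definition linear_between ::
  "('f \<Rightarrow> 'u::plus \<Rightarrow> 'u) \<Rightarrow> 'u set \<Rightarrow> ('f \<Rightarrow> 'v::plus \<Rightarrow> 'v) \<Rightarrow> 'v set \<Rightarrow> ('u \<Rightarrow> 'v) \<Rightarrow> bool"
where
  "linear_between sc S sc' T f \<longleftrightarrow>
     f ` S \<subseteq> T \<and>
     (\<forall>x\<in>S. \<forall>y\<in>S. f (x + y) = f x + f y) \<and>
     (\<forall>c. \<forall>x\<in>S. f (sc c x) = sc' c (f x))"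

definition persistence_module :: "('f::field, 'v::ab_group_add) pmod \<Rightarrow> bool" where
  "persistence_module V \<longleftrightarrow>
     vector_space (scl V) \<and>
     (\<forall>t. module.subspace (scl V) (spc V t)) \<and>
     (\<forall>s t. s \<le> t \<longrightarrow> linear_between (scl V) (spc V s) (scl V) (spc V t) (smap V s t)) \<and>
     (\<forall>t. \<forall>v\<in>spc V t. smap V t t v = v) \<and>
     (\<forall>r s t. r \<le> s \<longrightarrow> s \<le> t \<longrightarrow> (\<forall>v\<in>spc V r. smap V s t (smap V r s v) = smap V r t v))"

definition pm_morphism ::
  "('f::field, 'u::ab_group_add) pmod \<Rightarrow> ('f, 'v::ab_group_add) pmod \<Rightarrow> (real \<Rightarrow> 'u \<Rightarrow> 'v) \<Rightarrow> bool"
where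
  "pm_morphism U V \<phi> \<longleftrightarrow>
     (\<forall>t. linear_between (scl U) (spc U t) (scl V) (spc V t) (\<phi> t)) \<and>
     (\<forall>s t. s \<le> t \<longrightarrow> (\<forall>u\<in>spc U s. \<phi> t (smap U s t u) = smap V s t (\<phi> s u)))"

definition pm_iso ::
  "('f::field, 'u::ab_group_add) pmod \<Rightarrow> ('f, 'v::ab_group_add) pmod \<Rightarrow>
   (real \<Rightarrow> 'u \<Rightarrow> 'v) \<Rightarrow> (real \<Rightarrow> 'v \<Rightarrow> 'u) \<Rightarrow> bool"
where
  "pm_iso U V f g \<longleftrightarrow>
     pm_morphism U V f \<and> pm_morphism V U g \<and>
     (\<forall>t. \<forall>u\<in>spc U t. g t (f t u) = u) \<and>
     (\<forall>t. \<forall>v\<in>spc V t. f t (g t v) = v)"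

definition pm_shift :: "real \<Rightarrow> ('f, 'v) pmod \<Rightarrow> ('f, 'v) pmod" where
  "pm_shift e V =
     \<lparr>scl = scl V, spc = (\<lambda>t. spc V (t + e)), smap = (\<lambda>s t. smap V (s + e) (t + e))\<rparr>"

definition interval_module :: "real set \<Rightarrow> ('f::field, 'f) pmod" where
  "interval_module L =
     \<lparr>scl = (*),
      spc = (\<lambda>t. if t \<in> L then UNIV else {0}),
      smap = (\<lambda>s t x. if s \<in> L \<and> t \<in> L then x else 0)\<rparr>"

text \<open>Elements of a direct sum over \<open>I\<close> are the finitely supported families, extended by
  \<open>0\<close> outside \<open>I\<close>.\<close>

definition direct_sum :: "'i set \<Rightarrow> ('i \<Rightarrow> ('f, 'v::zero) pmod) \<Rightarrow> ('f, 'i \<Rightarrow> 'v) pmod" where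
  "direct_sum I M =
     \<lparr>scl = (\<lambda>c g i. scl (M i) c (g i)),
      spc = (\<lambda>t. {g. (\<forall>i\<in>I. g i \<in> spc (M i) t) \<and> (\<forall>i. i \<notin> I \<longrightarrow> g i = 0) \<and> finite {i. g i \<noteq> 0}}),
      smap = (\<lambda>s t g i. if i \<in> I then smap (M i) s t (g i) else 0)\<rparr>"

definition bar_sum ::
  "'i set \<Rightarrow> ('i \<Rightarrow> dreal) \<Rightarrow> ('i \<Rightarrow> dreal) \<Rightarrow> ('f::field, 'i \<Rightarrow> 'f) pmod" where
  "bar_sum I b d = direct_sum I (\<lambda>i. interval_module (bar (b i) (d i)))"

text \<open>An interval decomposition of \<open>V\<close>: \<open>\<iota>\<close> is an isomorphism from the sum of the bars
  to \<open>V\<close>, and \<open>\<pi>\<close> is its inverse.\<close>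

definition interval_decomposition ::
  "'i set \<Rightarrow> ('i \<Rightarrow> dreal) \<Rightarrow> ('i \<Rightarrow> dreal) \<Rightarrow> ('f::field, 'v::ab_group_add) pmod \<Rightarrow>
   (real \<Rightarrow> ('i \<Rightarrow> 'f) \<Rightarrow> 'v) \<Rightarrow> (real \<Rightarrow> 'v \<Rightarrow> 'i \<Rightarrow> 'f) \<Rightarrow> bool"
where
  "interval_decomposition I b d V \<iota> \<pi> \<longleftrightarrow> pm_iso (bar_sum I b d) V \<iota> \<pi>"

lemma persistence_module_bar_sum: "persistence_module (bar_sum I b d :: ('f::field, 'i \<Rightarrow> 'f) pmod)"
proof -
  let ?sc = "\<lambda>(c::'f) (g::'i \<Rightarrow> 'f) i. c * g i"
  let ?L = "\<lambda>i. bar (b i) (d i)"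
  let ?B = "bar_sum I b d :: ('f, 'i \<Rightarrow> 'f) pmod"
  interpret vector_space ?sc
    by unfold_locales (auto simp: fun_eq_iff algebra_simps)
  have scl: "scl ?B = ?sc"
    by (simp add: bar_sum_def direct_sum_def interval_module_def)
  have spc: "g \<in> spc ?B t \<longleftrightarrow> (\<forall>i. i \<notin> I \<or> t \<notin> ?L i \<longrightarrow> g i = 0) \<and> finite {i. g i \<noteq> 0}" for t g
    unfolding bar_sum_def direct_sum_def interval_module_def by auto
  have smap: "smap ?B s t g = (\<lambda>i. if i \<in> I \<and> s \<in> ?L i \<and> t \<in> ?L i then g i else 0)" for s t g
    unfolding bar_sum_def direct_sum_def interval_module_def by auto
  have mid: "s \<in> bar x y" if "r \<in> bar x y" "t \<in> bar x y" "r \<le> s" "s \<le> t" for r s t x y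
  proof -
    have "Dec r False \<le> Dec s False" "Dec s True \<le> Dec t True" using that by auto
    then show ?thesis using that(1,2) by (meson mem_bar_iff order_trans)
  qed
  have fin_add: "finite {i. g i + h i \<noteq> 0}" if "finite {i. g i \<noteq> 0}" "finite {i. h i \<noteq> 0}"
    for g h :: "'i \<Rightarrow> 'f"
    by (rule finite_subset[OF _ finite_UnI[OF that]]) auto
  have fin_smap: "finite {i. smap ?B s t g i \<noteq> 0}" if "finite {i. g i \<noteq> 0}" for s t g
    by (rule finite_subset[OF _ that]) (auto simp: smap)
  have sub: "subspace (spc ?B t)" for t
  proof (rule subspaceI)
    show "0 \<in> spc ?B t" by (simp add: spc)
    show "x + y \<in> spc ?B t" if "x \<in> spc ?B t" "y \<in> spc ?B t" for x y
      using that fin_add[of x y] by (simp add: spc)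
    show "?sc c x \<in> spc ?B t" if "x \<in> spc ?B t" for c x
      using that by (simp add: spc)
  qed
  have lin: "linear_between ?sc (spc ?B s) ?sc (spc ?B t) (smap ?B s t)" for s t
    unfolding linear_between_def
  proof (intro conjI ballI allI)
    show "smap ?B s t ` spc ?B s \<subseteq> spc ?B t"
    proof
      fix h assume "h \<in> smap ?B s t ` spc ?B s"
      then obtain g where g: "g \<in> spc ?B s" "h = smap ?B s t g" by blast
      have "finite {i. h i \<noteq> 0}" using g fin_smap[of g s t] by (simp add: spc)
      then show "h \<in> spc ?B t" using g(2) by (simp add: spc smap)
    qed
  qed (simp_all add: smap fun_eq_iff)
  have idn: "smap ?B t t v = v" if "v \<in> spc ?B t" for t v
    using that by (simp add: spc smap fun_eq_iff)
  have comp: "smap ?B s t (smap ?B r s v) = smap ?B r t v" if "r \<le> s" "s \<le> t" for r s t v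
    using mid[OF _ _ that] unfolding smap fun_eq_iff by auto
  show ?thesis
    unfolding persistence_module_def scl using vector_space_axioms sub lin idn comp by blast
qed

lemma interval_decomposition_shift:
  fixes V :: "('f::field, 'v::ab_group_add) pmod"
  assumes "interval_decomposition I b d V \<iota> \<pi>"
  shows "interval_decomposition I (\<lambda>i. dshift (b i) (- e)) (\<lambda>i. dshift (d i) (- e))
           (pm_shift e V) (\<lambda>t. \<iota> (t + e)) (\<lambda>t. \<pi> (t + e))"
proof -
  have "bar_sum I (\<lambda>i. dshift (b i) (- e)) (\<lambda>i. dshift (d i) (- e)) =
      pm_shift e (bar_sum I b d :: ('f, _) pmod)"
    by (simp add: bar_sum_def direct_sum_def interval_module_def pm_shift_def mem_bar_dshift cong: if_cong)
  then show ?thesis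
    using assms
    by (simp add: interval_decomposition_def pm_iso_def pm_morphism_def pm_shift_def)
qed

definition interleaving ::
  "real \<Rightarrow> ('f::field, 'u::ab_group_add) pmod \<Rightarrow> ('f, 'v::ab_group_add) pmod \<Rightarrow>
   (real \<Rightarrow> 'u \<Rightarrow> 'v) \<Rightarrow> (real \<Rightarrow> 'v \<Rightarrow> 'u) \<Rightarrow> bool"
where
  "interleaving \<epsilon> U V \<phi> \<psi> \<longleftrightarrow>
     pm_morphism U (pm_shift \<epsilon> V) \<phi> \<and> pm_morphism V (pm_shift \<epsilon> U) \<psi> \<and>
     (\<forall>t. \<forall>u\<in>spc U t. \<psi> (t + \<epsilon>) (\<phi> t u) = smap U t (t + 2 * \<epsilon>) u) \<and>
     (\<forall>t. \<forall>v\<in>spc V t. \<phi> (t + \<epsilon>) (\<psi> t v) = smap V t (t + 2 * \<epsilon>) v)"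


section \<open>Matrices of morphisms\<close>

text \<open>Here \<open>\<iota>\<close> is the isomorphism from the sum of the bars \<open>(a' j, c' j)\<close> to the source
  of \<open>\<phi>\<close>, and \<open>\<pi>\<close> the isomorphism from the target of \<open>\<phi>\<close> to the sum of the bars
  \<open>(a i, c i)\<close>. Only the entries of \<open>X\<close> in \<open>I \<times> J\<close> are relevant.\<close>

definition represents ::
  "'j set \<Rightarrow> ('j \<Rightarrow> dreal) \<Rightarrow> ('j \<Rightarrow> dreal) \<Rightarrow> (real \<Rightarrow> ('j \<Rightarrow> 'f) \<Rightarrow> 'u) \<Rightarrow>
   'i set \<Rightarrow> ('i \<Rightarrow> dreal) \<Rightarrow> ('i \<Rightarrow> dreal) \<Rightarrow> (real \<Rightarrow> 'v \<Rightarrow> 'i \<Rightarrow> 'f) \<Rightarrow>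
   ('i \<Rightarrow> 'j \<Rightarrow> 'f::field) \<Rightarrow> (real \<Rightarrow> 'u \<Rightarrow> 'v) \<Rightarrow> bool"
where
  "represents J a' c' \<iota> I a c \<pi> X \<phi> \<longleftrightarrow>
     (\<forall>i\<in>I. \<forall>j\<in>J. a i > a' j \<or> c i > c' j \<longrightarrow> X i j = 0) \<and>
     (\<forall>i\<in>I. \<forall>j\<in>J. \<forall>t \<in> bar (a i) (c i) \<inter> bar (a' j) (c' j). \<forall>x.
        \<pi> t (\<phi> t (\<iota> t (\<lambda>k. if k = j then x else 0))) i = X i j * x)"

definition trivial_entry :: "('j \<Rightarrow> dreal) \<Rightarrow> ('i \<Rightarrow> dreal) \<Rightarrow> 'i \<Rightarrow> 'j \<Rightarrow> bool" where
  "trivial_entry a' c i j \<longleftrightarrow> c i \<le> a' j"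

text \<open>A total order on a finite set is given by the list of its elements in increasing
  order.\<close>

definition enumerates :: "'a list \<Rightarrow> 'a set \<Rightarrow> bool" where
  "enumerates xs S \<longleftrightarrow> distinct xs \<and> set xs = S"

definition standard_order ::
  "'j set \<Rightarrow> ('j \<Rightarrow> dreal) \<Rightarrow> 'i set \<Rightarrow> ('i \<Rightarrow> dreal) \<Rightarrow> 'i list \<Rightarrow> 'j list \<Rightarrow> bool"
where
  "standard_order J a' I c rows cols \<longleftrightarrow>
     enumerates cols J \<and> enumerates rows I \<and>
     (\<forall>m < length cols. \<forall>n < length cols. a' (cols ! m) < a' (cols ! n) \<longrightarrow> m < n) \<and>
     (\<forall>m < length rows. \<forall>n < length rows. c (rows ! m) > c (rows ! n) \<longrightarrow> m < n)"

definition col_pivot :: "'i list \<Rightarrow> ('i \<Rightarrow> 'j \<Rightarrow> 'f::zero) \<Rightarrow> 'j \<Rightarrow> 'i option" where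
  "col_pivot rows X j = find (\<lambda>i. X i j \<noteq> 0) rows"

definition col_step ::
  "'i list \<Rightarrow> 'j \<Rightarrow> 'j set \<Rightarrow> ('i \<Rightarrow> 'j \<Rightarrow> 'f::field) \<Rightarrow> 'i \<Rightarrow> 'j \<Rightarrow> 'f"
where
  "col_step rows j later X =
     (case col_pivot rows X j of
        None \<Rightarrow> X
      | Some p \<Rightarrow> (\<lambda>i k. if k \<in> later then X i k - X p k / X p j * X i j else X i k))"

fun col_reduce ::
  "'i list \<Rightarrow> 'j list \<Rightarrow> ('i \<Rightarrow> 'j \<Rightarrow> 'f::field) \<Rightarrow> 'i \<Rightarrow> 'j \<Rightarrow> 'f"
where
  "col_reduce rows [] X = X"
| "col_reduce rows (j # cols) X = col_reduce rows cols (col_step rows j (set cols) X)"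

text \<open>A column no longer changes once it is processed, so its pivot can be read off the
  reduced matrix.\<close>

lemma col_reduce_unchanged: "j \<notin> set cols \<Longrightarrow> col_reduce rows cols X i j = X i j"
  by (induction cols arbitrary: X) (auto simp: col_step_def split: option.splits)

definition col_pivots :: "'i list \<Rightarrow> 'j list \<Rightarrow> ('i \<Rightarrow> 'j \<Rightarrow> 'f::zero) \<Rightarrow> ('i \<times> 'j) set" where
  "col_pivots rows cols X = {(i, j). j \<in> set cols \<and> col_pivot rows X j = Some i}"

definition mtranspose :: "('i \<Rightarrow> 'j \<Rightarrow> 'f) \<Rightarrow> 'j \<Rightarrow> 'i \<Rightarrow> 'f" where
  "mtranspose X = (\<lambda>j i. X i j)"

definition row_reduce ::
  "'i list \<Rightarrow> 'j list \<Rightarrow> ('i \<Rightarrow> 'j \<Rightarrow> 'f::field) \<Rightarrow> 'i \<Rightarrow> 'j \<Rightarrow> 'f"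
where
  "row_reduce rows cols X = mtranspose (col_reduce cols rows (mtranspose X))"

definition row_pivots :: "'i list \<Rightarrow> 'j list \<Rightarrow> ('i \<Rightarrow> 'j \<Rightarrow> 'f::zero) \<Rightarrow> ('i \<times> 'j) set" where
  "row_pivots rows cols X = (col_pivots cols rows (mtranspose X))\<inverse>"


section \<open>Matchings\<close>

definition matching :: "'i set \<Rightarrow> 'j set \<Rightarrow> ('i \<times> 'j) set \<Rightarrow> bool" where
  "matching I J M \<longleftrightarrow> M \<subseteq> I \<times> J \<and> single_valued M \<and> single_valued (M\<inverse>)"

definition contains_closed_interval :: "real \<Rightarrow> real set \<Rightarrow> bool" where
  "contains_closed_interval l L \<longleftrightarrow> (\<exists>s. {s..s + l} \<subseteq> L)"

definition eps_matching ::
  "real \<Rightarrow> 'i set \<Rightarrow> ('i \<Rightarrow> dreal) \<Rightarrow> ('i \<Rightarrow> dreal) \<Rightarrow> 'j set \<Rightarrow> ('j \<Rightarrow> dreal) \<Rightarrow> ('j \<Rightarrow> dreal) \<Rightarrow>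
   ('i \<times> 'j) set \<Rightarrow> bool"
where
  "eps_matching \<epsilon> I b d J b' d' M \<longleftrightarrow>
     matching I J M \<and>
     (\<forall>i\<in>I. contains_closed_interval (2 * \<epsilon>) (bar (b i) (d i)) \<longrightarrow> i \<in> Domain M) \<and>
     (\<forall>j\<in>J. contains_closed_interval (2 * \<epsilon>) (bar (b' j) (d' j)) \<longrightarrow> j \<in> Range M) \<and>
     (\<forall>(i, j)\<in>M.
        bar (b i) (d i) \<subseteq> bar (dshift (b' j) (- \<epsilon>)) (dshift (d' j) \<epsilon>) \<and>
        bar (b' j) (d' j) \<subseteq> bar (dshift (b i) (- \<epsilon>)) (dshift (d i) \<epsilon>))"

end

theory Submission
  imports Defs
begin

text \<open>Let \<open>Z\<close> represent the other morphism \<open>\<psi>\<close> of the interleaving. Where an entry \<open>(j, k)\<close> of the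
  structure map \<open>U \<rightarrow> U\<^bsub>_+2\<epsilon>\<^esub>\<close> is nontrivial, \<open>Z X\<close> agrees with the identity matrix; if \<open>j\<close> is
  a bar longer than \<open>2\<epsilon>\<close>, this covers every column up to \<open>j\<close>. Column operations only add earlier
  columns to later ones, so the diagonal entry of \<open>Z\<close> times the reduced matrix is still \<open>1\<close> at
  \<open>j\<close>: column \<open>j\<close> has a pivot, in a row no later than some row \<open>l\<close> with \<open>Z\<^bsub>j,l\<^esub> \<noteq> 0\<close>, which bounds
  the death of the pivot's row from below. The same argument with \<open>X Z\<close> and row reduction bounds
  births. Both apply to the same set of positions because column and row reduction have the same
  pivots.\<close>

section \<open>Decorated reals\<close>

lemma dshift_dshift [simp]: "dshift (dshift x s) t = dshift x (s + t)"
  by (cases x) auto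

lemma dshift_0 [simp]: "dshift x 0 = x"
  by (cases x) auto

lemma dshift_le_dshift_iff [simp]: "dshift x t \<le> dshift y t \<longleftrightarrow> x \<le> y"
  by (cases x; cases y) auto

lemma dshift_less_dshift_iff [simp]: "dshift x t < dshift y t \<longleftrightarrow> x < y"
  by (simp add: less_le_not_le)

lemma dshift_le_iff: "dshift x t \<le> y \<longleftrightarrow> x \<le> dshift y (- t)"
  using dshift_le_dshift_iff[of x t "dshift y (- t)"] by simp

lemma dshift_less_iff: "dshift x t < y \<longleftrightarrow> x < dshift y (- t)"
  using dshift_less_dshift_iff[of x t "dshift y (- t)"] by simp

lemma dshift_mono: "x \<le> y \<Longrightarrow> s \<le> t \<Longrightarrow> dshift x s \<le> dshift y t"
  by (cases x; cases y) auto

lemma bar_mono: "b' \<le> b \<Longrightarrow> d \<le> d' \<Longrightarrow> bar b d \<subseteq> bar b' d'"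
  by (auto simp: mem_bar_iff)

text \<open>The left end \<open>s\<close> of the closed interval lies in the bar from
  \<open>b\<close> to \<open>dshift d (- l)\<close>, which is therefore nonempty. This turns length
  into a strict inequality of decorated endpoints.\<close>

lemma less_dshift_if_contains_closed_interval:
  assumes "contains_closed_interval l (bar b d)" and "l \<ge> 0"
  shows "b < dshift d (- l)"
proof -
  obtain s where "{s..s + l} \<subseteq> bar b d"
    using assms(1) by (auto simp: contains_closed_interval_def)
  then have "s \<in> bar b d" "s + l \<in> bar b d"
    using assms(2) by auto
  then have "s \<in> bar b (dshift d (- l))"
    using dshift_le_iff[of "Dec s True" l d] by (simp add: mem_bar_iff)
  then show ?thesis
    using bar_nonempty_iff by blast
qed


section \<open>Matrices of morphisms\<close>

lemma spc_bar_sum_iff: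
  assumes "finite I"
  shows "g \<in> spc (bar_sum I b d) t \<longleftrightarrow> (\<forall>i. i \<notin> I \<or> t \<notin> bar (b i) (d i) \<longrightarrow> g i = 0)"
proof -
  have "finite {i. g i \<noteq> 0}" if "\<forall>i. i \<notin> I \<longrightarrow> g i = 0"
    using that by (intro finite_subset[OF _ assms]) auto
  then show ?thesis
    by (auto simp: bar_sum_def direct_sum_def interval_module_def)
qed

lemma smap_bar_sum:
  "smap (bar_sum I b d) s t g =
     (\<lambda>i. if i \<in> I \<and> s \<in> bar (b i) (d i) \<and> t \<in> bar (b i) (d i) then g i else 0)"
  by (auto simp: bar_sum_def direct_sum_def interval_module_def)

lemma scl_bar_sum: "scl (bar_sum I b d) = (\<lambda>c g i. c * g i)"
  by (simp add: bar_sum_def direct_sum_def interval_module_def)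

lemma linear_between_0:
  fixes f :: "'u::monoid_add \<Rightarrow> 'v::group_add"
  assumes "linear_between sc S sc' T f" and "0 \<in> S"
  shows "f 0 = 0"
proof -
  have "f (0 + 0) = f 0 + f 0"
    using assms unfolding linear_between_def by blast
  then show ?thesis
    using add_left_imp_eq[of "f 0" "f 0" 0] by simp
qed

lemma pm_morphism_mem: "pm_morphism U V f \<Longrightarrow> u \<in> spc U t \<Longrightarrow> f t u \<in> spc V t"
  by (simp add: pm_morphism_def linear_between_def image_subset_iff)

lemma pm_morphism_smap:
  "pm_morphism U V f \<Longrightarrow> s \<le> t \<Longrightarrow> u \<in> spc U s \<Longrightarrow> f t (smap U s t u) = smap V s t (f s u)"
  by (simp add: pm_morphism_def)

lemma pm_morphism_linear:
  "pm_morphism U V f \<Longrightarrow> linear_between (scl U) (spc U t) (scl V) (spc V t) (f t)"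
  by (simp add: pm_morphism_def)

lemma pm_morphism_comp:
  assumes "pm_morphism U V f" and "pm_morphism V W g"
  shows "pm_morphism U W (\<lambda>t u. g t (f t u))"
  using assms pm_morphism_mem[OF assms(1)]
  by (simp add: pm_morphism_def linear_between_def image_subset_iff)

section \<open>Coordinates of morphisms between sums of bars\<close>

abbreviation unit_vec :: "'i \<Rightarrow> 'f::zero \<Rightarrow> 'i \<Rightarrow> 'f" where
  "unit_vec j x \<equiv> (\<lambda>k. if k = j then x else 0)"

lemma unit_vec_in_spc:
  "finite I \<Longrightarrow> j \<in> I \<Longrightarrow> t \<in> bar (b j) (d j) \<Longrightarrow> unit_vec j x \<in> spc (bar_sum I b d) t"
  by (auto simp: spc_bar_sum_iff)

text \<open>Additivity is known only on the space at \<open>t\<close>, so the sum runs over the bars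
  containing \<open>t\<close>, whose unit vectors lie in that space. Induction over sets of such
  bars builds up \<open>x\<close> one coordinate at a time.\<close>

lemma linear_bar_sum_expand:
  fixes f :: "('j \<Rightarrow> 'f::field) \<Rightarrow> ('i \<Rightarrow> 'f)"
  assumes lin: "linear_between (scl (bar_sum J a' c')) (spc (bar_sum J a' c') t)
                  (scl (bar_sum I a c)) T f"
    and J: "finite J" and x: "x \<in> spc (bar_sum J a' c') t"
  shows "f x i = (\<Sum>j | j \<in> J \<and> t \<in> bar (a' j) (c' j). f (unit_vec j (x j)) i)"
proof -
  have add: "f (x + y) i = f x i + f y i"
    if "x \<in> spc (bar_sum J a' c') t" "y \<in> spc (bar_sum J a' c') t" for x y
    using lin that by (simp add: linear_between_def)
  have zero: "f 0 i = 0"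
    using linear_between_0[OF lin] J by (simp add: spc_bar_sum_iff)
  have *: "f (\<lambda>j. if j \<in> S then x j else 0) i = (\<Sum>j\<in>S. f (unit_vec j (x j)) i)"
    if "S \<subseteq> {j \<in> J. t \<in> bar (a' j) (c' j)}" for S
  proof -
    have "finite S"
      using that J by (auto intro: finite_subset)
    then show ?thesis
      using that
    proof (induction S)
      case empty
      then show ?case using zero by (simp add: zero_fun_def)
    next
      case (insert k S)
      have "(\<lambda>j. if j \<in> insert k S then x j else 0) =
          unit_vec k (x k) + (\<lambda>j. if j \<in> S then x j else 0)"
        using insert.hyps by (auto simp: fun_eq_iff)
      moreover have "(\<lambda>j. if j \<in> S then x j else 0) \<in> spc (bar_sum J a' c') t"
        using insert.prems J by (auto simp: spc_bar_sum_iff)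
      moreover have "unit_vec k (x k) \<in> spc (bar_sum J a' c') t"
        using insert.prems J by (auto intro: unit_vec_in_spc)
      ultimately show ?case
        using insert by (simp add: add)
    qed
  qed
  have "x = (\<lambda>j. if j \<in> {j \<in> J. t \<in> bar (a' j) (c' j)} then x j else 0)"
    using x J by (auto simp: spc_bar_sum_iff fun_eq_iff)
  then show ?thesis
    using *[OF order_refl] by simp
qed

lemma conjugate_morphism:
  assumes "interval_decomposition J a' c' A \<iota>\<^sub>A \<pi>\<^sub>A" and "interval_decomposition I a c B \<iota>\<^sub>B \<pi>\<^sub>B"
    and "pm_morphism A B \<phi>"
  shows "pm_morphism (bar_sum J a' c') (bar_sum I a c) (\<lambda>t x. \<pi>\<^sub>B t (\<phi> t (\<iota>\<^sub>A t x)))"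
proof -
  have "pm_morphism (bar_sum J a' c') A \<iota>\<^sub>A" "pm_morphism B (bar_sum I a c) \<pi>\<^sub>B"
    using assms by (simp_all add: interval_decomposition_def pm_iso_def)
  from pm_morphism_comp[OF pm_morphism_comp[OF this(1) assms(3)] this(2)] show ?thesis .
qed

text \<open>\<open>represents\<close> evaluates entries only at times common to both bars. The sum
  may still run over all of \<open>J\<close>, since the coordinates of \<open>x\<close> at bars
  missing \<open>t\<close> are \<open>0\<close>.\<close>

lemma represents_expand:
  assumes A: "interval_decomposition J a' c' A \<iota>\<^sub>A \<pi>\<^sub>A"
    and B: "interval_decomposition I a c B \<iota>\<^sub>B \<pi>\<^sub>B"
    and "pm_morphism A B \<phi>" and rep: "represents J a' c' \<iota>\<^sub>A I a c \<pi>\<^sub>B X \<phi>"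
    and J: "finite J" and i: "i \<in> I" "t \<in> bar (a i) (c i)"
    and x: "x \<in> spc (bar_sum J a' c') t"
  shows "\<pi>\<^sub>B t (\<phi> t (\<iota>\<^sub>A t x)) i = (\<Sum>j\<in>J. X i j * x j)"
proof -
  have lin: "linear_between (scl (bar_sum J a' c')) (spc (bar_sum J a' c') t)
      (scl (bar_sum I a c)) (spc (bar_sum I a c) t) (\<lambda>x. \<pi>\<^sub>B t (\<phi> t (\<iota>\<^sub>A t x)))"
    by (rule pm_morphism_linear[OF conjugate_morphism[OF assms(1-3)]])
  have "\<pi>\<^sub>B t (\<phi> t (\<iota>\<^sub>A t x)) i =
      (\<Sum>j | j \<in> J \<and> t \<in> bar (a' j) (c' j). \<pi>\<^sub>B t (\<phi> t (\<iota>\<^sub>A t (unit_vec j (x j)))) i)"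
    by (rule linear_bar_sum_expand[OF lin J x])
  also have "\<dots> = (\<Sum>j | j \<in> J \<and> t \<in> bar (a' j) (c' j). X i j * x j)"
    using rep i by (intro sum.cong refl) (auto simp: represents_def)
  also have "\<dots> = (\<Sum>j\<in>J. X i j * x j)"
    using J x by (intro sum.mono_neutral_left) (auto simp: spc_bar_sum_iff)
  finally show ?thesis .
qed

section \<open>Matrix entries determined by naturality\<close>

lemma mem_bar_between:
  assumes "b \<le> Dec r False" "Dec t True \<le> d" "r \<le> s" "s \<le> t"
  shows "s \<in> bar b d"
proof -
  have "Dec r False \<le> Dec s False" "Dec s True \<le> Dec t True"
    using assms by auto
  then show ?thesis
    using assms(1,2) by (meson mem_bar_iff order_trans)
qed

text \<open>Naturality is applied between \<open>t\<close> and a time \<open>s\<close> at which only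
  one of the two bars is alive. If bar \<open>i\<close> is born later than bar \<open>j\<close>, the
  image has no \<open>i\<close> coordinate at the earlier time \<open>s\<close>, hence none at
  \<open>t\<close>. If bar \<open>i\<close> dies later, the unit vector is \<open>0\<close> at the
  later time \<open>s\<close>, while the \<open>i\<close> coordinate of its image survives unchanged
  from \<open>t\<close> to \<open>s\<close>.\<close>

lemma bar_sum_entry_eq_0:
  fixes \<Phi> :: "real \<Rightarrow> ('j \<Rightarrow> 'f::field) \<Rightarrow> ('i \<Rightarrow> 'f)"
  assumes morph: "pm_morphism (bar_sum J a' c') (bar_sum I a c) \<Phi>"
    and fin: "finite J" and ij: "i \<in> I" "j \<in> J"
    and t: "t \<in> bar (a i) (c i)" "t \<in> bar (a' j) (c' j)"
    and out: "a i > a' j \<or> c i > c' j"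
  shows "\<Phi> t (unit_vec j x) i = 0"
  using out
proof
  assume "a i > a' j"
  then obtain s where "s \<in> bar (a' j) (a i)"
    using bar_nonempty_iff by blast
  then have s: "a' j \<le> Dec s False" "Dec s True \<le> a i"
    by (auto simp: mem_bar_iff)
  have notin: "s \<notin> bar (a i) (c i)"
    using order_trans[OF s(2), of "Dec s False"] by (auto simp: mem_bar_iff)
  have "Dec s True \<le> Dec t False"
    using s(2) t(1) by (meson mem_bar_iff order_trans)
  then have "s \<le> t"
    by auto
  then have s_in: "s \<in> bar (a' j) (c' j)"
    using mem_bar_between[OF s(1)] t(2) by (auto simp: mem_bar_iff)
  have "\<Phi> t (smap (bar_sum J a' c') s t (unit_vec j x)) =
      smap (bar_sum I a c) s t (\<Phi> s (unit_vec j x))"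
    using fin ij s_in \<open>s \<le> t\<close> by (intro pm_morphism_smap[OF morph] unit_vec_in_spc)
  moreover have "smap (bar_sum J a' c') s t (unit_vec j x) = unit_vec j x"
    using ij s_in t by (auto simp: smap_bar_sum)
  ultimately show ?thesis
    using notin by (simp add: smap_bar_sum)
next
  assume "c i > c' j"
  then obtain s where "s \<in> bar (c' j) (c i)"
    using bar_nonempty_iff by blast
  then have s: "c' j \<le> Dec s False" "Dec s True \<le> c i"
    by (auto simp: mem_bar_iff)
  have notin: "s \<notin> bar (a' j) (c' j)"
    using order_trans[OF _ s(1), of "Dec s True"] by (auto simp: mem_bar_iff)
  have "Dec t True \<le> Dec s False"
    using s(1) t(2) by (meson mem_bar_iff order_trans)
  then have "t \<le> s"
    by auto
  then have s_in: "s \<in> bar (a i) (c i)"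
    using mem_bar_between[OF _ s(2)] t(1) by (auto simp: mem_bar_iff)
  have "\<Phi> s (smap (bar_sum J a' c') t s (unit_vec j x)) =
      smap (bar_sum I a c) t s (\<Phi> t (unit_vec j x))"
    using fin ij t \<open>t \<le> s\<close> by (intro pm_morphism_smap[OF morph] unit_vec_in_spc)
  moreover have "smap (bar_sum J a' c') t s (unit_vec j x) = 0"
    using notin by (auto simp: smap_bar_sum)
  moreover have "\<Phi> s 0 = 0"
    using linear_between_0[OF pm_morphism_linear[OF morph]] fin by (simp add: spc_bar_sum_iff)
  ultimately have "0 = smap (bar_sum I a c) t s (\<Phi> t (unit_vec j x))"
    by simp
  from fun_cong[OF this, of i] show ?thesis
    using ij t(1) s_in by (simp add: smap_bar_sum)
qed

lemma bar_sum_entry_const: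
  fixes \<Phi> :: "real \<Rightarrow> ('j \<Rightarrow> 'f::field) \<Rightarrow> ('i \<Rightarrow> 'f)"
  assumes morph: "pm_morphism (bar_sum J a' c') (bar_sum I a c) \<Phi>"
    and fin: "finite J" and ij: "i \<in> I" "j \<in> J"
    and s: "s \<in> bar (a i) (c i)" "s \<in> bar (a' j) (c' j)"
    and t: "t \<in> bar (a i) (c i)" "t \<in> bar (a' j) (c' j)"
  shows "\<Phi> s (unit_vec j x) i = \<Phi> t (unit_vec j x) i"
proof -
  have *: "\<Phi> s (unit_vec j x) i = \<Phi> t (unit_vec j x) i"
    if "s \<le> t" and s: "s \<in> bar (a i) (c i)" "s \<in> bar (a' j) (c' j)"
      and t: "t \<in> bar (a i) (c i)" "t \<in> bar (a' j) (c' j)" for s t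
  proof -
    have "\<Phi> t (smap (bar_sum J a' c') s t (unit_vec j x)) =
        smap (bar_sum I a c) s t (\<Phi> s (unit_vec j x))"
      using fin ij s \<open>s \<le> t\<close> by (intro pm_morphism_smap[OF morph] unit_vec_in_spc)
    moreover have "smap (bar_sum J a' c') s t (unit_vec j x) = unit_vec j x"
      using ij s t by (auto simp: smap_bar_sum)
    ultimately show ?thesis
      using ij s t by (simp add: smap_bar_sum)
  qed
  show ?thesis
    using *[of s t] *[of t s] s t by fastforce
qed

text \<open>Provides a matrix for the second morphism of an interleaving. Entries with endpoints out
  of order may be set to \<open>0\<close> because the morphism vanishes there, and all other entries
  are independent of the time at which they are read off.\<close>

lemma ex_represents:
  assumes A: "interval_decomposition J a' c' A \<iota>\<^sub>A \<pi>\<^sub>A"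
    and B: "interval_decomposition I a c B \<iota>\<^sub>B \<pi>\<^sub>B"
    and \<phi>: "pm_morphism A B \<phi>" and J: "finite J"
  shows "\<exists>X. represents J a' c' \<iota>\<^sub>A I a c \<pi>\<^sub>B X \<phi>"
proof -
  define \<Phi> where "\<Phi> t x = \<pi>\<^sub>B t (\<phi> t (\<iota>\<^sub>A t x))" for t x
  have morph: "pm_morphism (bar_sum J a' c') (bar_sum I a c) \<Phi>"
    unfolding \<Phi>_def by (rule conjugate_morphism[OF A B \<phi>])
  \<comment> \<open>For disjoint bars with endpoints in order the choice yields an arbitrary value;
    \<open>represents\<close> leaves such entries unconstrained.\<close>
  define X where "X i j = (if a i > a' j \<or> c i > c' j then 0
    else \<Phi> (SOME t. t \<in> bar (a i) (c i) \<inter> bar (a' j) (c' j)) (unit_vec j 1) i)" for i j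
  have "\<Phi> t (unit_vec j x) i = X i j * x"
    if ij: "i \<in> I" "j \<in> J" and t: "t \<in> bar (a i) (c i)" "t \<in> bar (a' j) (c' j)" for i j t x
  proof -
    have "unit_vec j 1 \<in> spc (bar_sum J a' c') t"
      using J ij t by (intro unit_vec_in_spc)
    moreover have "linear_between (scl (bar_sum J a' c')) (spc (bar_sum J a' c') t)
        (scl (bar_sum I a c)) (spc (bar_sum I a c) t) (\<Phi> t)"
      by (rule pm_morphism_linear[OF morph])
    ultimately have "\<Phi> t (scl (bar_sum J a' c') x (unit_vec j 1)) =
        scl (bar_sum I a c) x (\<Phi> t (unit_vec j 1))"
      unfolding linear_between_def by blast
    moreover have "(\<lambda>k. x * unit_vec j 1 k) = unit_vec j x"
      by auto
    ultimately have scale: "\<Phi> t (unit_vec j x) i = \<Phi> t (unit_vec j 1) i * x"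
      by (simp add: scl_bar_sum mult.commute)
    show ?thesis
    proof (cases "a i > a' j \<or> c i > c' j")
      case True
      then show ?thesis
        using bar_sum_entry_eq_0[OF morph J ij t] by (simp add: X_def)
    next
      case False
      define s where "s = (SOME t. t \<in> bar (a i) (c i) \<inter> bar (a' j) (c' j))"
      have "\<exists>t. t \<in> bar (a i) (c i) \<inter> bar (a' j) (c' j)"
        using t by auto
      from someI_ex[OF this] have "s \<in> bar (a i) (c i)" "s \<in> bar (a' j) (c' j)"
        by (simp_all add: s_def)
      from bar_sum_entry_const[OF morph J ij t this]
      have "\<Phi> t (unit_vec j 1) i = \<Phi> s (unit_vec j 1) i" .
      then show ?thesis
        using False scale by (simp add: X_def s_def)
    qed
  qed
  then have "represents J a' c' \<iota>\<^sub>A I a c \<pi>\<^sub>B X \<phi>"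
    by (auto simp: represents_def X_def \<Phi>_def)
  then show ?thesis
    by (intro exI)
qed

text \<open>The composite of the two morphisms is the structure map of \<open>U\<close> over a
  distance of 2\<epsilon>, whose entries are those of the identity matrix wherever they are visible
  in the module. The strict inequality supplies a time at which the entry can be tested.\<close>

lemma interleaving_matrix_product:
  fixes U :: "('f::field, 'u::ab_group_add) pmod" and V :: "('f, 'v::ab_group_add) pmod"
  assumes "\<epsilon> \<ge> 0" and fin: "finite I" "finite J"
    and U: "interval_decomposition J b' d' U \<iota>\<^sub>U \<pi>\<^sub>U"
    and V: "interval_decomposition I b d V \<iota>\<^sub>V \<pi>\<^sub>V"
    and int: "interleaving \<epsilon> U V \<phi> \<psi>"
    and X: "represents J b' d' \<iota>\<^sub>U
           I (\<lambda>i. dshift (b i) (- \<epsilon>)) (\<lambda>i. dshift (d i) (- \<epsilon>)) (\<lambda>t. \<pi>\<^sub>V (t + \<epsilon>)) X \<phi>"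
    and Z: "represents I b d \<iota>\<^sub>V
           J (\<lambda>i. dshift (b' i) (- \<epsilon>)) (\<lambda>i. dshift (d' i) (- \<epsilon>)) (\<lambda>t. \<pi>\<^sub>U (t + \<epsilon>)) Z \<psi>"
    and jk: "j \<in> J" "k \<in> J" and less: "b' k < dshift (d' j) (- 2 * \<epsilon>)"
  shows "(\<Sum>i\<in>I. Z j i * X i k) = (if j = k then 1 else 0)"
proof -
  have X0: "dshift (b i) (- \<epsilon>) \<le> b' k" "dshift (d i) (- \<epsilon>) \<le> d' k" if "X i k \<noteq> 0" "i \<in> I" for i
    using X jk that by (auto simp: represents_def not_less[symmetric])
  have Z0: "dshift (b' j) (- \<epsilon>) \<le> b i" "dshift (d' j) (- \<epsilon>) \<le> d i" if "Z j i \<noteq> 0" "i \<in> I" for i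
    using Z jk that by (auto simp: represents_def not_less[symmetric])
  show ?thesis
  \<comment> \<open>If bar \<open>k\<close> and bar \<open>j\<close> shifted down by 2\<epsilon>
    have endpoints out of order, every summand vanishes: two nonzero factors would chain the
    endpoints through bar \<open>i\<close>. Otherwise the product is evaluated on a unit
    vector.\<close>
  proof (cases "dshift (b' j) (- 2 * \<epsilon>) \<le> b' k \<and> dshift (d' j) (- 2 * \<epsilon>) \<le> d' k")
    case False
    then have "j \<noteq> k"
      using \<open>\<epsilon> \<ge> 0\<close> dshift_mono[of "b' k" "b' k" "- 2 * \<epsilon>" 0]
        dshift_mono[of "d' k" "d' k" "- 2 * \<epsilon>" 0] by auto
    moreover have "Z j i * X i k = 0" if "i \<in> I" for i
    proof (rule ccontr)
      assume "Z j i * X i k \<noteq> 0"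
      then have "b i \<le> dshift (b' k) \<epsilon>" "dshift (b' j) (- \<epsilon>) \<le> b i"
          "d i \<le> dshift (d' k) \<epsilon>" "dshift (d' j) (- \<epsilon>) \<le> d i"
        using X0[OF _ that] Z0[OF _ that] by (auto simp: dshift_le_iff)
      then have "dshift (b' j) (- \<epsilon>) \<le> dshift (b' k) \<epsilon>" "dshift (d' j) (- \<epsilon>) \<le> dshift (d' k) \<epsilon>"
        by (blast intro: order_trans)+
      then show False
        using False by (auto simp: dshift_le_iff)
    qed
    ultimately show ?thesis
      by (simp del: mult_eq_0_iff)
  next
    case True
    \<comment> \<open>At \<open>t\<close> bar \<open>k\<close> has been born and bar
      \<open>j\<close> will still not have died 2\<epsilon> later. The case assumption supplies the
      two remaining endpoint conditions.\<close>
    obtain t where "t \<in> bar (b' k) (dshift (d' j) (- 2 * \<epsilon>))"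
      using less bar_nonempty_iff by blast
    then have "b' k \<le> Dec t False" "Dec t True \<le> dshift (d' j) (- 2 * \<epsilon>)"
      by (auto simp: mem_bar_iff)
    then have tk: "t \<in> bar (b' k) (d' k)"
      and tj: "t \<in> bar (dshift (b' j) (- 2 * \<epsilon>)) (dshift (d' j) (- 2 * \<epsilon>))"
      using True by (auto simp: mem_bar_iff)
    define y where "y = \<pi>\<^sub>V (t + \<epsilon>) (\<phi> t (\<iota>\<^sub>U t (unit_vec k 1)))"
    have e: "unit_vec k 1 \<in> spc (bar_sum J b' d') t"
      using fin jk tk by (intro unit_vec_in_spc)
    have \<phi>: "pm_morphism U (pm_shift \<epsilon> V) \<phi>" and \<psi>: "pm_morphism V (pm_shift \<epsilon> U) \<psi>"
      and \<psi>\<phi>: "\<And>t u. u \<in> spc U t \<Longrightarrow> \<psi> (t + \<epsilon>) (\<phi> t u) = smap U t (t + 2 * \<epsilon>) u"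
      using int by (simp_all add: interleaving_def)
    have \<iota>\<^sub>U: "pm_morphism (bar_sum J b' d') U \<iota>\<^sub>U" and \<pi>\<^sub>U: "pm_morphism U (bar_sum J b' d') \<pi>\<^sub>U"
      and \<pi>\<iota>\<^sub>U: "\<And>t x. x \<in> spc (bar_sum J b' d') t \<Longrightarrow> \<pi>\<^sub>U t (\<iota>\<^sub>U t x) = x"
      using U by (simp_all add: interval_decomposition_def pm_iso_def)
    have \<pi>\<^sub>V: "pm_morphism V (bar_sum I b d) \<pi>\<^sub>V"
      and \<iota>\<pi>\<^sub>V: "\<And>t v. v \<in> spc V t \<Longrightarrow> \<iota>\<^sub>V t (\<pi>\<^sub>V t v) = v"
      using V by (simp_all add: interval_decomposition_def pm_iso_def)
    have u: "\<iota>\<^sub>U t (unit_vec k 1) \<in> spc U t"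
      by (rule pm_morphism_mem[OF \<iota>\<^sub>U e])
    have v: "\<phi> t (\<iota>\<^sub>U t (unit_vec k 1)) \<in> spc V (t + \<epsilon>)"
      using pm_morphism_mem[OF \<phi> u] by (simp add: pm_shift_def)
    have y: "y \<in> spc (bar_sum I b d) (t + \<epsilon>)"
      unfolding y_def by (rule pm_morphism_mem[OF \<pi>\<^sub>V v])
    have \<iota>y: "\<iota>\<^sub>V (t + \<epsilon>) y = \<phi> t (\<iota>\<^sub>U t (unit_vec k 1))"
      unfolding y_def by (rule \<iota>\<pi>\<^sub>V[OF v])
    have "t + \<epsilon> \<in> bar (dshift (b' j) (- \<epsilon>)) (dshift (d' j) (- \<epsilon>))"
      using tj by (simp add: mem_bar_dshift add.assoc)
    from represents_expand[OF V interval_decomposition_shift[OF U] \<psi> Z fin(1) jk(1) this y]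
    have "(\<Sum>i\<in>I. Z j i * y i) =
        \<pi>\<^sub>U (t + 2 * \<epsilon>) (\<psi> (t + \<epsilon>) (\<phi> t (\<iota>\<^sub>U t (unit_vec k 1)))) j"
      by (simp add: \<iota>y add.assoc)
    also have "\<dots> = \<pi>\<^sub>U (t + 2 * \<epsilon>) (smap U t (t + 2 * \<epsilon>) (\<iota>\<^sub>U t (unit_vec k 1))) j"
      by (simp only: \<psi>\<phi>[OF u])
    also have "\<dots> = smap (bar_sum J b' d') t (t + 2 * \<epsilon>) (\<pi>\<^sub>U t (\<iota>\<^sub>U t (unit_vec k 1))) j"
      using pm_morphism_smap[OF \<pi>\<^sub>U _ u] \<open>\<epsilon> \<ge> 0\<close> by simp
    also have "\<pi>\<^sub>U t (\<iota>\<^sub>U t (unit_vec k 1)) = unit_vec k 1"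
      by (rule \<pi>\<iota>\<^sub>U[OF e])
    also have "smap (bar_sum J b' d') t (t + 2 * \<epsilon>) (unit_vec k 1) j = (if j = k then 1 else 0 :: 'f)"
      using jk tk tj by (auto simp: smap_bar_sum mem_bar_dshift)
    finally have "(\<Sum>i\<in>I. Z j i * y i) = (if j = k then 1 else 0)" .
    \<comment> \<open>The vector \<open>y\<close> is known to agree with column \<open>k\<close> of
      \<open>X\<close> only at the bars of \<open>V\<close> alive at \<open>t + \<epsilon>\<close>.
      For any other \<open>i\<close>, \<open>y i\<close> is \<open>0\<close>, and
      \<open>Z j i\<close> and \<open>X i k\<close> cannot both be nonzero, since their endpoint
      inequalities would put \<open>t + \<epsilon>\<close> into bar \<open>i\<close>.\<close>
    moreover have "Z j i * y i = Z j i * X i k" if i: "i \<in> I" for i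
    proof (cases "t + \<epsilon> \<in> bar (b i) (d i)")
      case True
      then have "t \<in> bar (dshift (b i) (- \<epsilon>)) (dshift (d i) (- \<epsilon>))"
        by (simp add: mem_bar_dshift)
      then have "y i = X i k"
        using X i jk tk unfolding represents_def y_def by fastforce
      then show ?thesis
        by simp
    next
      case False
      have "Z j i * X i k = 0"
      proof (rule ccontr)
        assume "Z j i * X i k \<noteq> 0"
        then have "dshift (b i) (- \<epsilon>) \<le> b' k" "dshift (d' j) (- \<epsilon>) \<le> d i"
          using X0[OF _ i] Z0[OF _ i] by auto
        moreover from this(2) have "dshift (d' j) (- 2 * \<epsilon>) \<le> dshift (d i) (- \<epsilon>)"
          by (simp add: dshift_le_iff)
        ultimately have "t \<in> bar (dshift (b i) (- \<epsilon>)) (dshift (d i) (- \<epsilon>))"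
          using tk tj by (auto simp: mem_bar_iff)
        then show False
          using False by (simp add: mem_bar_dshift)
      qed
      moreover have "y i = 0"
        using y False fin by (simp add: spc_bar_sum_iff)
      ultimately show ?thesis
        by simp
    qed
    ultimately show ?thesis
      by simp
  qed
qed

lemma interleaving_sym: "interleaving \<epsilon> U V \<phi> \<psi> \<Longrightarrow> interleaving \<epsilon> V U \<psi> \<phi>"
  by (auto simp: interleaving_def)


section \<open>Ordered reduction\<close>

text \<open>The row and column orders are compared through these positions; an element off the list
  gets the length of the list.\<close>

primrec index_of :: "'a list \<Rightarrow> 'a \<Rightarrow> nat" where
  "index_of [] x = 0"
| "index_of (y # ys) x = (if y = x then 0 else Suc (index_of ys x))"

lemma index_of_less_length: "x \<in> set xs \<Longrightarrow> index_of xs x < length xs"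
  by (induction xs) auto

lemma nth_index_of: "x \<in> set xs \<Longrightarrow> xs ! index_of xs x = x"
  by (induction xs) auto

lemma index_of_eq_iff:
  "x \<in> set xs \<Longrightarrow> y \<in> set xs \<Longrightarrow> index_of xs x = index_of xs y \<longleftrightarrow> x = y"
  by (metis nth_index_of)

lemma find_Some_iff_index_of:
  "find P xs = Some x \<longleftrightarrow>
     x \<in> set xs \<and> P x \<and> (\<forall>y\<in>set xs. index_of xs y < index_of xs x \<longrightarrow> \<not> P y)"
  by (induction xs) auto

lemma col_pivot_eq_Some_iff:
  "col_pivot rows X j = Some i \<longleftrightarrow>
     i \<in> set rows \<and> X i j \<noteq> 0 \<and> (\<forall>l\<in>set rows. index_of rows l < index_of rows i \<longrightarrow> X l j = 0)"
  by (auto simp: col_pivot_def find_Some_iff_index_of)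

lemma col_pivot_eq_None_iff: "col_pivot rows X j = None \<longleftrightarrow> (\<forall>i\<in>set rows. X i j = 0)"
  by (auto simp: col_pivot_def find_None_iff)

lemma col_pivot_cong:
  "(\<And>i. i \<in> set rows \<Longrightarrow> X i j = Y i k) \<Longrightarrow> col_pivot rows X j = col_pivot rows Y k"
  by (auto simp: col_pivot_def intro: find_cong)

lemma ex_col_pivot:
  assumes "X i j \<noteq> 0" and "i \<in> set rows" and "j \<in> set cols"
  shows "\<exists>p. (p, j) \<in> col_pivots rows cols X \<and> index_of rows p \<le> index_of rows i"
proof -
  obtain p where "col_pivot rows X j = Some p"
    using assms col_pivot_eq_None_iff by fastforce
  then show ?thesis
    using assms by (auto simp: col_pivots_def col_pivot_eq_Some_iff not_less[symmetric])
qed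

section \<open>Column reduction as multiplication by a unitriangular matrix\<close>

definition unitriangular :: "'a list \<Rightarrow> ('a \<Rightarrow> 'a \<Rightarrow> 'f::field) \<Rightarrow> bool" where
  "unitriangular xs T \<longleftrightarrow>
     (\<forall>x\<in>set xs. T x x = 1) \<and>
     (\<forall>x\<in>set xs. \<forall>y\<in>set xs. index_of xs y < index_of xs x \<longrightarrow> T x y = 0)"

lemma col_step_diff:
  "\<exists>c. \<forall>i. \<forall>k\<in>set cols. col_step rows j (set cols) X i k = X i k - c k * X i j"
proof (cases "col_pivot rows X j")
  case None
  then show ?thesis
    by (intro exI[of _ "\<lambda>k. 0"]) (simp add: col_step_def)
next
  case (Some p)
  then show ?thesis
    by (intro exI[of _ "\<lambda>k. X p k / X p j"]) (simp add: col_step_def)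
qed

lemma col_step_self: "j \<notin> later \<Longrightarrow> col_step rows j later X i j = X i j"
  by (simp add: col_step_def split: option.split)

lemma col_step_pivot_row:
  "col_pivot rows X j = Some p \<Longrightarrow> k \<in> later \<Longrightarrow> col_step rows j later X p k = 0"
  using col_pivot_eq_Some_iff[of rows X j p] by (simp add: col_step_def)

text \<open>Each step adds multiples of one column to later columns, and such operations compose to
  right multiplication by \<open>T\<close>. The entry \<open>T k j\<close> is the multiple of the
  original column \<open>k\<close> in the reduced column \<open>j\<close>, so it vanishes when
  \<open>k\<close> comes after \<open>j\<close>.\<close>

lemma col_reduce_factor:
  assumes "distinct cols"
  shows "\<exists>T. unitriangular cols T \<and>
    (\<forall>i. \<forall>j\<in>set cols. col_reduce rows cols X i j = (\<Sum>k\<in>set cols. X i k * T k j))"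
  using assms
proof (induction cols arbitrary: X)
  case Nil
  then show ?case
    by (simp add: unitriangular_def)
next
  case (Cons j cols)
  then have j: "j \<notin> set cols"
    by simp
  define X1 where "X1 = col_step rows j (set cols) X"
  obtain c where c: "\<And>i k. k \<in> set cols \<Longrightarrow> X1 i k = X i k - c k * X i j"
    unfolding X1_def using col_step_diff[of cols rows j X] by blast
  obtain T where T: "unitriangular cols T"
    and red: "\<And>i k. k \<in> set cols \<Longrightarrow> col_reduce rows cols X1 i k = (\<Sum>l\<in>set cols. X1 i l * T l k)"
    using Cons by force
  \<comment> \<open>\<open>T\<close> is bordered by a row and a column for \<open>j\<close>. Column
    \<open>j\<close> never changes, so its column is a unit vector. Row \<open>j\<close> collects
    the multiples \<open>c m\<close> of column \<open>j\<close> that the first step subtracts from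
    the columns \<open>m\<close>, weighted by the later operations \<open>T m k\<close>.\<close>
  define T' where "T' l k = (if k = j then (if l = j then 1 else 0)
    else if l = j then - (\<Sum>m\<in>set cols. c m * T m k) else T l k)" for l k
  have "unitriangular (j # cols) T'"
    using T j by (auto simp: unitriangular_def T'_def)
  moreover have "col_reduce rows (j # cols) X i k = (\<Sum>l\<in>set (j # cols). X i l * T' l k)"
    if k: "k \<in> set (j # cols)" for i k
  proof (cases "k = j")
    case True
    have "col_reduce rows cols X1 i j = X i j"
      using j by (simp add: col_reduce_unchanged X1_def col_step_self)
    moreover have "(\<Sum>l\<in>set cols. X i l * T' l j) = 0"
      using j by (intro sum.neutral) (auto simp: T'_def)
    ultimately show ?thesis
      using True j by (simp add: X1_def T'_def)
  next
    case False
    then have "col_reduce rows (j # cols) X i k = (\<Sum>l\<in>set cols. (X i l - c l * X i j) * T l k)"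
      using k red c by (simp add: X1_def)
    also have "\<dots> = (\<Sum>l\<in>set cols. X i l * T l k) - X i j * (\<Sum>l\<in>set cols. c l * T l k)"
      by (simp add: sum_subtractf sum_distrib_left algebra_simps)
    also have "(\<Sum>l\<in>set cols. X i l * T l k) = (\<Sum>l\<in>set cols. X i l * T' l k)"
      using False j by (intro sum.cong) (auto simp: T'_def)
    finally show ?thesis
      using False j by (simp add: T'_def)
  qed
  ultimately show ?case
    by blast
qed

text \<open>Every reduced entry is a linear combination of entries of \<open>X\<close> in the same
  row. Hence a pivot row cleared in one step stays clear in the later ones.\<close>

lemma col_reduce_eq_0:
  assumes "distinct cols" and "\<And>k. k \<in> set cols \<Longrightarrow> X i k = 0" and "j \<in> set cols"
  shows "col_reduce rows cols X i j = 0"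
  using col_reduce_factor[OF assms(1), of rows X] assms(2,3) by auto

section \<open>Uniqueness of pivots and agreement of the two reductions\<close>

lemma single_valued_converse_col_pivots: "single_valued ((col_pivots rows cols X)\<inverse>)"
  by (auto simp: single_valued_def col_pivots_def)

text \<open>Processing a column clears its pivot row in all later columns. Operations among those
  columns cannot make that row nonzero again, so none of them can have its pivot there.\<close>

lemma single_valued_reduced_col_pivots:
  assumes "distinct cols"
  shows "single_valued (col_pivots rows cols (col_reduce rows cols X))"
  using assms
proof (induction cols arbitrary: X)
  case Nil
  then show ?case
    by (simp add: col_pivots_def)
next
  case (Cons j cols)
  then have j: "j \<notin> set cols"
    by simp
  define X1 where "X1 = col_step rows j (set cols) X"
  define Y where "Y = col_reduce rows cols X1"
  have pivot_j: "col_pivot rows Y j = col_pivot rows X j"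
    using j by (intro col_pivot_cong) (simp add: Y_def X1_def col_reduce_unchanged col_step_self)
  have "k \<notin> set cols" if "col_pivot rows Y j = Some p" "col_pivot rows Y k = Some p" for k p
  proof
    assume "k \<in> set cols"
    then have "Y p k = 0"
      unfolding Y_def using Cons.prems that(1) pivot_j
      by (intro col_reduce_eq_0) (auto simp: X1_def col_step_pivot_row)
    then show False
      using that(2) by (simp add: col_pivot_eq_Some_iff)
  qed
  moreover have "single_valued (col_pivots rows cols Y)"
    unfolding Y_def using Cons by simp
  ultimately have "single_valued (col_pivots rows (j # cols) Y)"
    unfolding single_valued_def col_pivots_def by auto
  then show ?case
    by (simp add: X1_def Y_def)
qed

text \<open>Multiplication by the transpose of \<open>S\<close> adds multiples of earlier rows to
  later ones. Down to the pivot only zeros are added, so the entries above it stay \<open>0\<close>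
  and the pivot keeps its value because \<open>S p p = 1\<close>.\<close>

lemma col_pivot_unitriangular_mult:
  assumes S: "unitriangular rows S"
  shows "col_pivot rows (\<lambda>i j. \<Sum>l\<in>set rows. S l i * Y l j) j = col_pivot rows Y j"
proof (cases "col_pivot rows Y j")
  case None
  moreover from this have "col_pivot rows (\<lambda>i j. \<Sum>l\<in>set rows. S l i * Y l j) j = None"
    by (simp add: col_pivot_eq_None_iff)
  ultimately show ?thesis
    by simp
next
  case (Some p)
  then have p: "p \<in> set rows" "Y p j \<noteq> 0"
    and Y0: "\<And>l. l \<in> set rows \<Longrightarrow> index_of rows l < index_of rows p \<Longrightarrow> Y l j = 0"
    by (auto simp: col_pivot_eq_Some_iff)
  have S0: "S l i = 0" if "l \<in> set rows" "i \<in> set rows" "index_of rows i < index_of rows l" for l i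
    using S that by (simp add: unitriangular_def)
  have "S l p * Y l j = 0" if "l \<in> set rows - {p}" for l
    using that p S0[of l p] Y0[of l] index_of_eq_iff[of l rows p]
    by (cases "index_of rows l < index_of rows p") auto
  then have "(\<Sum>l\<in>set rows - {p}. S l p * Y l j) = 0"
    by (intro sum.neutral) blast
  then have "(\<Sum>l\<in>set rows. S l p * Y l j) = S p p * Y p j"
    using p by (simp add: sum.remove[of _ p])
  also have "\<dots> = Y p j"
    using S p by (simp add: unitriangular_def)
  finally have "(\<Sum>l\<in>set rows. S l p * Y l j) = Y p j" .
  moreover have "(\<Sum>l\<in>set rows. S l i * Y l j) = 0"
    if i: "i \<in> set rows" "index_of rows i < index_of rows p" for i
  proof (intro sum.neutral ballI)
    fix l assume "l \<in> set rows"
    then show "S l i * Y l j = 0"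
      using i S0[of l i] Y0[of l] by (cases "index_of rows i < index_of rows l") auto
  qed
  ultimately have "col_pivot rows (\<lambda>i j. \<Sum>l\<in>set rows. S l i * Y l j) j = Some p"
    using p by (simp add: col_pivot_eq_Some_iff)
  then show ?thesis
    using Some by simp
qed

text \<open>A column pivot that is not the pivot of its row would give another one further left, and
  hence an infinite descent.\<close>

lemma col_pivot_imp_row_pivot:
  assumes "single_valued (col_pivots rows cols P)"
    and "single_valued (col_pivots cols rows (mtranspose P))"
    and "(i, j) \<in> col_pivots rows cols P"
  shows "(j, i) \<in> col_pivots cols rows (mtranspose P)"
  using assms(3)
proof (induction "index_of cols j" arbitrary: i j rule: less_induct)
  case less
  then have ij: "i \<in> set rows" "j \<in> set cols" "P i j \<noteq> 0"
    by (auto simp: col_pivots_def col_pivot_eq_Some_iff)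
  then obtain j1 where j1: "(j1, i) \<in> col_pivots cols rows (mtranspose P)"
    and le: "index_of cols j1 \<le> index_of cols j"
    using ex_col_pivot[of "mtranspose P" j i cols rows] by (auto simp: mtranspose_def)
  then have j1': "j1 \<in> set cols" "P i j1 \<noteq> 0"
    by (auto simp: col_pivots_def col_pivot_eq_Some_iff mtranspose_def)
  show ?case
  proof (cases "j1 = j")
    case True
    then show ?thesis
      using j1 by simp
  next
    case False
    then have "index_of cols j1 < index_of cols j"
      using le ij j1' index_of_eq_iff[of j1 cols j] by simp
    moreover obtain i1 where i1: "(i1, j1) \<in> col_pivots rows cols P"
      using ex_col_pivot[of P i j1 rows cols] ij j1' by auto
    ultimately have "(j1, i1) \<in> col_pivots cols rows (mtranspose P)"
      using less.hyps by blast
    then have "i1 = i"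
      using j1 assms(2) by (auto dest: single_valuedD)
    then have "j1 = j"
      using i1 less.prems assms(1) by (auto dest: single_valuedD)
    then show ?thesis
      using False by simp
  qed
qed

lemma col_pivots_cong:
  "(\<And>i j. i \<in> set rows \<Longrightarrow> j \<in> set cols \<Longrightarrow> X i j = Y i j) \<Longrightarrow>
   col_pivots rows cols X = col_pivots rows cols Y"
  unfolding col_pivots_def using col_pivot_cong[of rows X _ Y] by (metis (no_types, lifting))

text \<open>With \<open>X T\<close> the column reduction and \<open>S\<^sup>t X\<close> the row reduction, \<open>S\<^sup>t X T\<close> has the
  column pivots of the former and the row pivots of the latter.\<close>

lemma col_pivots_eq_row_pivots:
  assumes dist: "distinct rows" "distinct cols"
  shows "col_pivots rows cols (col_reduce rows cols X) = row_pivots rows cols (row_reduce rows cols X)"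
proof -
  define Y where "Y = col_reduce rows cols X"
  define W where "W = col_reduce cols rows (mtranspose X)"
  obtain T where T: "unitriangular cols T"
    and Y: "\<And>i j. j \<in> set cols \<Longrightarrow> Y i j = (\<Sum>k\<in>set cols. X i k * T k j)"
    using col_reduce_factor[OF dist(2), of rows X] by (auto simp: Y_def)
  obtain S where S: "unitriangular rows S"
    and W: "\<And>i j. i \<in> set rows \<Longrightarrow> W j i = (\<Sum>l\<in>set rows. X l j * S l i)"
    using col_reduce_factor[OF dist(1), of cols "mtranspose X"] by (auto simp: W_def mtranspose_def)
  define P where "P i j = (\<Sum>l\<in>set rows. S l i * Y l j)" for i j
  have col: "col_pivots rows cols P = col_pivots rows cols Y"
    unfolding P_def col_pivots_def by (simp add: col_pivot_unitriangular_mult[OF S])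
  \<comment> \<open>Reassociating the triple product: transposed, it is \<open>W\<close> multiplied
    on the left by the transpose of \<open>T\<close>, which keeps the pivots of \<open>W\<close> in
    place.\<close>
  have "mtranspose P j i = (\<Sum>k\<in>set cols. T k j * W k i)"
    if "i \<in> set rows" "j \<in> set cols" for i j
  proof -
    have "mtranspose P j i = (\<Sum>l\<in>set rows. \<Sum>k\<in>set cols. S l i * (X l k * T k j))"
      using that by (simp add: mtranspose_def P_def Y sum_distrib_left)
    also have "\<dots> = (\<Sum>k\<in>set cols. \<Sum>l\<in>set rows. S l i * (X l k * T k j))"
      by (rule sum.swap)
    finally show ?thesis
      using that by (simp add: W sum_distrib_left mult_ac)
  qed
  then have "col_pivots cols rows (mtranspose P) =
      col_pivots cols rows (\<lambda>j i. \<Sum>k\<in>set cols. T k j * W k i)"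
    by (intro col_pivots_cong)
  then have row: "col_pivots cols rows (mtranspose P) = col_pivots cols rows W"
    unfolding col_pivots_def by (simp add: col_pivot_unitriangular_mult[OF T])
  have sv: "single_valued (col_pivots rows cols P)" "single_valued (col_pivots cols rows (mtranspose P))"
    unfolding col row Y_def W_def using dist by (simp_all add: single_valued_reduced_col_pivots)
  have "mtranspose (mtranspose P) = P"
    by (simp add: mtranspose_def)
  \<comment> \<open>The backward direction is the same descent applied to the transpose.\<close>
  then have "(i, j) \<in> col_pivots rows cols P \<longleftrightarrow> (j, i) \<in> col_pivots cols rows (mtranspose P)" for i j
    using col_pivot_imp_row_pivot[OF sv] col_pivot_imp_row_pivot[of cols rows "mtranspose P" j i] sv
    by auto
  then show ?thesis
    unfolding row_pivots_def row_reduce_def col row Y_def[symmetric] W_def[symmetric]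
    by (auto simp: mtranspose_def)
qed

text \<open>The reduced column \<open>j\<close> combines only columns of \<open>X\<close> up to
  \<open>j\<close>, so one of these must be nonzero in the pivot's row. This carries endpoint
  inequalities from nonzero entries of \<open>X\<close> over to pivots.\<close>

lemma col_pivot_nonzero_entry:
  assumes "distinct cols" and "(i, j) \<in> col_pivots rows cols (col_reduce rows cols X)"
  shows "\<exists>k\<in>set cols. index_of cols k \<le> index_of cols j \<and> X i k \<noteq> 0"
proof (rule ccontr)
  obtain T where T: "unitriangular cols T"
    and Y: "\<And>i j. j \<in> set cols \<Longrightarrow> col_reduce rows cols X i j = (\<Sum>k\<in>set cols. X i k * T k j)"
    using col_reduce_factor[OF assms(1), of rows X] by auto
  have j: "j \<in> set cols" "col_reduce rows cols X i j \<noteq> 0"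
    using assms(2) by (auto simp: col_pivots_def col_pivot_eq_Some_iff)
  assume "\<not> ?thesis"
  then have "X i k * T k j = 0" if "k \<in> set cols" for k
    using that T j by (cases "index_of cols j < index_of cols k") (auto simp: unitriangular_def)
  then show False
    using j by (simp add: Y del: mult_eq_0_iff)
qed

text \<open>With \<open>Y = X T\<close>, the product of \<open>z\<close> with column
  \<open>j\<close> of \<open>Y\<close> is \<open>1\<close>: columns before \<open>j\<close>
  contribute \<open>0\<close> by the assumption on \<open>z\<close>, columns after \<open>j\<close>
  by triangularity. So some \<open>z l * Y l j\<close> is nonzero, and the pivot of column
  \<open>j\<close> lies in row \<open>l\<close> or an earlier one.\<close>

lemma left_inverse_col_pivot:
  fixes X :: "'i \<Rightarrow> 'j \<Rightarrow> 'f::field"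
  assumes "distinct cols" and j: "j \<in> set cols"
    and z: "\<And>k. k \<in> set cols \<Longrightarrow> index_of cols k \<le> index_of cols j \<Longrightarrow>
      (\<Sum>i\<in>set rows. z i * X i k) = (if j = k then 1 else 0)"
  shows "\<exists>i l. (i, j) \<in> col_pivots rows cols (col_reduce rows cols X) \<and>
    l \<in> set rows \<and> index_of rows i \<le> index_of rows l \<and> z l \<noteq> 0"
proof -
  define Y where "Y = col_reduce rows cols X"
  obtain T where T: "unitriangular cols T"
    and Y: "\<And>i j. j \<in> set cols \<Longrightarrow> Y i j = (\<Sum>k\<in>set cols. X i k * T k j)"
    using col_reduce_factor[OF assms(1), of rows X] by (auto simp: Y_def)
  have "(\<Sum>i\<in>set rows. z i * Y i j) = (\<Sum>i\<in>set rows. \<Sum>k\<in>set cols. z i * (X i k * T k j))"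
    using j by (simp add: Y sum_distrib_left)
  also have "\<dots> = (\<Sum>k\<in>set cols. \<Sum>i\<in>set rows. z i * (X i k * T k j))"
    by (rule sum.swap)
  also have "\<dots> = (\<Sum>k\<in>set cols. (\<Sum>i\<in>set rows. z i * X i k) * T k j)"
    by (simp add: sum_distrib_right mult.assoc)
  also have "\<dots> = (\<Sum>k\<in>set cols. if j = k then 1 else 0)"
  proof (intro sum.cong refl)
    fix k assume k: "k \<in> set cols"
    show "(\<Sum>i\<in>set rows. z i * X i k) * T k j = (if j = k then 1 else 0)"
      using T j k z[OF k] by (cases "index_of cols j < index_of cols k") (auto simp: unitriangular_def)
  qed
  also have "\<dots> = 1"
    using j by simp
  finally have "(\<Sum>i\<in>set rows. z i * Y i j) \<noteq> 0"
    by simp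
  then obtain l where l: "l \<in> set rows" "z l * Y l j \<noteq> 0"
    by (rule sum.not_neutral_contains_not_neutral)
  then show ?thesis
    using ex_col_pivot[of Y l j rows cols] j by (auto simp: Y_def)
qed

section \<open>Standard order and endpoint bounds for pivots\<close>

lemma standard_order_index_of:
  assumes "standard_order J a' I c rows cols"
  shows "j \<in> J \<Longrightarrow> k \<in> J \<Longrightarrow> index_of cols k \<le> index_of cols j \<Longrightarrow> a' k \<le> a' j"
    and "i \<in> I \<Longrightarrow> l \<in> I \<Longrightarrow> index_of rows l \<le> index_of rows i \<Longrightarrow> c i \<le> c l"
  using assms
  by (metis standard_order_def enumerates_def index_of_less_length nth_index_of not_less)+

theorem theorem5p1:
  fixes \<epsilon> :: real
    and U :: "('f::field, 'u::ab_group_add) pmod"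
    and V :: "('f, 'v::ab_group_add) pmod"
    and I :: "'i set" and b d :: "'i \<Rightarrow> dreal"
    and J :: "'j set" and b' d' :: "'j \<Rightarrow> dreal"
    and \<iota>\<^sub>U :: "real \<Rightarrow> ('j \<Rightarrow> 'f) \<Rightarrow> 'u" and \<pi>\<^sub>U :: "real \<Rightarrow> 'u \<Rightarrow> 'j \<Rightarrow> 'f"
    and \<iota>\<^sub>V :: "real \<Rightarrow> ('i \<Rightarrow> 'f) \<Rightarrow> 'v" and \<pi>\<^sub>V :: "real \<Rightarrow> 'v \<Rightarrow> 'i \<Rightarrow> 'f"
    and \<phi> :: "real \<Rightarrow> 'u \<Rightarrow> 'v" and \<psi> :: "real \<Rightarrow> 'v \<Rightarrow> 'u"
    and X :: "'i \<Rightarrow> 'j \<Rightarrow> 'f"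
    and rows :: "'i list" and cols :: "'j list"
  assumes "\<epsilon> \<ge> 0"
    and "persistence_module U" and "persistence_module V"
    and "finite I" and "finite J"
    and "\<And>i. i \<in> I \<Longrightarrow> bar (b i) (d i) \<noteq> {}"
    and "\<And>j. j \<in> J \<Longrightarrow> bar (b' j) (d' j) \<noteq> {}"
    and "interval_decomposition J b' d' U \<iota>\<^sub>U \<pi>\<^sub>U"
    and "interval_decomposition I b d V \<iota>\<^sub>V \<pi>\<^sub>V"
    and "interleaving \<epsilon> U V \<phi> \<psi>"
    and "represents J b' d' \<iota>\<^sub>U
           I (\<lambda>i. dshift (b i) (- \<epsilon>)) (\<lambda>i. dshift (d i) (- \<epsilon>)) (\<lambda>t. \<pi>\<^sub>V (t + \<epsilon>)) X \<phi>"
    and "standard_order J b' I (\<lambda>i. dshift (d i) (- \<epsilon>)) rows cols"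
  shows "eps_matching \<epsilon> I b d J b' d'
           {(i, j) \<in> col_pivots rows cols (col_reduce rows cols X).
              \<not> trivial_entry b' (\<lambda>i. dshift (d i) (- \<epsilon>)) i j} \<and>
         eps_matching \<epsilon> I b d J b' d'
           {(i, j) \<in> row_pivots rows cols (row_reduce rows cols X).
              \<not> trivial_entry b' (\<lambda>i. dshift (d i) (- \<epsilon>)) i j}"
proof -
  have dist: "distinct rows" "distinct cols" and sets: "set rows = I" "set cols = J"
    using \<open>standard_order _ _ _ _ _ _\<close> by (auto simp: standard_order_def enumerates_def)
  note X = \<open>represents J b' d' _ _ _ _ _ X \<phi>\<close>
  note std = standard_order_index_of[OF \<open>standard_order _ _ _ _ _ _\<close>]
  have "pm_morphism V (pm_shift \<epsilon> U) \<psi>"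
    using assms(10) by (simp add: interleaving_def)
  from ex_represents[OF assms(9) interval_decomposition_shift[OF assms(8)] this assms(4)]
  obtain Z where Z: "represents I b d \<iota>\<^sub>V
      J (\<lambda>j. dshift (b' j) (- \<epsilon>)) (\<lambda>j. dshift (d' j) (- \<epsilon>)) (\<lambda>t. \<pi>\<^sub>U (t + \<epsilon>)) Z \<psi>"
    by blast
  have Z0: "dshift (b' j) (- \<epsilon>) \<le> b i" "dshift (d' j) (- \<epsilon>) \<le> d i"
    if "Z j i \<noteq> 0" "i \<in> I" "j \<in> J" for i j
    using Z that by (auto simp: represents_def not_less[symmetric])
  have X0: "dshift (b i) (- \<epsilon>) \<le> b' j" "dshift (d i) (- \<epsilon>) \<le> d' j"
    if "X i j \<noteq> 0" "i \<in> I" "j \<in> J" for i j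
    using X that by (auto simp: represents_def not_less[symmetric])
  define C where "C = col_pivots rows cols (col_reduce rows cols X)"
  have C: "C = (col_pivots cols rows (col_reduce cols rows (mtranspose X)))\<inverse>"
    using col_pivots_eq_row_pivots[OF dist, of X]
    by (simp add: C_def row_pivots_def row_reduce_def mtranspose_def)
  have C_sub: "C \<subseteq> I \<times> J"
    using sets by (auto simp: C_def col_pivots_def col_pivot_eq_Some_iff)
  have sv: "single_valued C" "single_valued (C\<inverse>)"
    using dist by (simp_all add: C_def single_valued_reduced_col_pivots single_valued_converse_col_pivots)
  \<comment> \<open>Columns up to \<open>j\<close> are born no later than bar \<open>j\<close>, so
    the product identity is available for all of them. The pivot lies in row \<open>l\<close> or
    earlier for some \<open>l\<close> with \<open>Z j l\<close> nonzero, and earlier rows die no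
    earlier.\<close>
  have col: "\<exists>i. (i, j) \<in> C \<and> dshift (d' j) (- \<epsilon>) \<le> d i"
    if j: "j \<in> J" and less: "b' j < dshift (d' j) (- 2 * \<epsilon>)" for j
  proof -
    have "(\<Sum>i\<in>I. Z j i * X i k) = (if j = k then 1 else 0)"
      if "k \<in> J" "index_of cols k \<le> index_of cols j" for k
      using interleaving_matrix_product[OF assms(1,4,5,8,9,10) X Z j that(1)] std(1)[OF j that] less
      by simp
    then obtain i l where "(i, j) \<in> C" "l \<in> I" "index_of rows i \<le> index_of rows l" "Z j l \<noteq> 0"
      using left_inverse_col_pivot[OF dist(2), of j "Z j" X rows] j by (auto simp: sets C_def)
    then show ?thesis
      using C_sub std(2)[of l i] Z0(2)[of j l] j by (auto intro: order_trans)
  qed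
  \<comment> \<open>The dual argument uses column \<open>i\<close> of \<open>Z\<close> on the
    transpose of \<open>X\<close>. Rows up to \<open>i\<close> die no earlier than bar
    \<open>i\<close>, so the product identity, with \<open>U\<close> and \<open>V\<close> exchanged,
    holds for all of them. The pivot lies in column \<open>k\<close> or earlier for some
    \<open>k\<close> with \<open>Z k i\<close> nonzero, and earlier columns are born no
    later.\<close>
  have row: "\<exists>j. (i, j) \<in> C \<and> dshift (b' j) (- \<epsilon>) \<le> b i"
    if i: "i \<in> I" and less: "b i < dshift (d i) (- 2 * \<epsilon>)" for i
  proof -
    have "(\<Sum>j\<in>J. Z j i * mtranspose X j l) = (if i = l then 1 else 0)"
      if l: "l \<in> I" "index_of rows l \<le> index_of rows i" for l
    proof -
      have "d i \<le> d l"
        using std(2)[OF i l] by simp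
      then have "b i < dshift (d l) (- 2 * \<epsilon>)"
        using less by (meson dshift_le_dshift_iff less_le_trans)
      from interleaving_matrix_product[OF assms(1,5,4,9,8) interleaving_sym[OF assms(10)] Z X l(1) i this]
      show ?thesis
        by (simp add: mtranspose_def mult.commute eq_commute)
    qed
    then obtain j k where "(i, j) \<in> C" "k \<in> J" "index_of cols j \<le> index_of cols k" "Z k i \<noteq> 0"
      using left_inverse_col_pivot[OF dist(1), of i "\<lambda>j. Z j i" "mtranspose X" cols] i
      by (auto simp: sets C)
    then show ?thesis
      using C_sub std(1)[of k j] Z0(1)[of k i] i by (auto simp: dshift_le_iff intro: order_trans)
  qed
  let ?M = "{(i, j) \<in> C. \<not> trivial_entry b' (\<lambda>i. dshift (d i) (- \<epsilon>)) i j}"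
  have "matching I J ?M"
    using C_sub sv unfolding matching_def single_valued_def by auto
  moreover have "j \<in> Range ?M"
    if j: "j \<in> J" and "contains_closed_interval (2 * \<epsilon>) (bar (b' j) (d' j))" for j
  proof -
    \<comment> \<open>The length of bar \<open>j\<close> makes \<open>col\<close> applicable, and
      the death bound it gives also forces the pivot into a nontrivial position.\<close>
    have less: "b' j < dshift (d' j) (- 2 * \<epsilon>)"
      using less_dshift_if_contains_closed_interval[OF that(2)] assms(1) by simp
    then obtain i where i: "(i, j) \<in> C" "dshift (d' j) (- \<epsilon>) \<le> d i"
      using col j by blast
    then have "dshift (d' j) (- 2 * \<epsilon>) \<le> dshift (d i) (- \<epsilon>)"
      by (simp add: dshift_le_iff)
    then have "\<not> trivial_entry b' (\<lambda>i. dshift (d i) (- \<epsilon>)) i j"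
      using less by (simp add: trivial_entry_def not_le)
    then show ?thesis
      using i by blast
  qed
  moreover have "i \<in> Domain ?M"
    if i: "i \<in> I" and "contains_closed_interval (2 * \<epsilon>) (bar (b i) (d i))" for i
  proof -
    \<comment> \<open>For a long bar of \<open>V\<close> it is the birth bound from
      \<open>row\<close> that makes the pivot nontrivial.\<close>
    have less: "b i < dshift (d i) (- 2 * \<epsilon>)"
      using less_dshift_if_contains_closed_interval[OF that(2)] assms(1) by simp
    then obtain j where j: "(i, j) \<in> C" "dshift (b' j) (- \<epsilon>) \<le> b i"
      using row i by blast
    then have "dshift (b' j) (- \<epsilon>) < dshift (d i) (- 2 * \<epsilon>)"
      using less by simp
    then have "\<not> trivial_entry b' (\<lambda>i. dshift (d i) (- \<epsilon>)) i j"
      by (simp add: trivial_entry_def not_le dshift_less_iff)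
    then show ?thesis
      using j by blast
  qed
  moreover have "bar (b i) (d i) \<subseteq> bar (dshift (b' j) (- \<epsilon>)) (dshift (d' j) \<epsilon>) \<and>
      bar (b' j) (d' j) \<subseteq> bar (dshift (b i) (- \<epsilon>)) (dshift (d i) \<epsilon>)"
    if ij: "(i, j) \<in> ?M" for i j
  proof -
    have "(i, j) \<in> C" and i: "i \<in> I" and j: "j \<in> J" and nontriv: "b' j < dshift (d i) (- \<epsilon>)"
      using ij C_sub by (auto simp: trivial_entry_def)
    then have "(i, j) \<in> col_pivots rows cols (col_reduce rows cols X)"
      and "(j, i) \<in> col_pivots cols rows (col_reduce cols rows (mtranspose X))"
      using C by (auto simp: C_def)
    \<comment> \<open>The column reduction gives a nonzero entry of \<open>X\<close> in row
      \<open>i\<close> at a column up to \<open>j\<close>, which bounds births; the row reduction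
      gives one in column \<open>j\<close> at a row up to \<open>i\<close>, which bounds
      deaths.\<close>
    from col_pivot_nonzero_entry[OF dist(2) this(1)] col_pivot_nonzero_entry[OF dist(1) this(2)]
    obtain k l where k: "k \<in> J" "index_of cols k \<le> index_of cols j" "X i k \<noteq> 0"
      and l: "l \<in> I" "index_of rows l \<le> index_of rows i" "X l j \<noteq> 0"
      by (auto simp: sets mtranspose_def)
    have 1: "dshift (b i) (- \<epsilon>) \<le> b' j"
      using X0(1)[OF k(3) i k(1)] std(1)[OF j k(1,2)] by simp
    have 2: "d i \<le> dshift (d' j) \<epsilon>"
      using X0(2)[OF l(3,1) j] std(2)[OF i l(1,2)] by (simp add: dshift_le_iff)
    \<comment> \<open>Nontriviality enters here. If bar \<open>j\<close> outlived bar
      \<open>i\<close> by more than \<epsilon>, the birth of \<open>j\<close> would precede its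
      death shifted down by 2\<epsilon>, so \<open>col\<close> would give a pivot in column
      \<open>j\<close> satisfying the bound; that column has only one pivot.\<close>
    have 3: "dshift (d' j) (- \<epsilon>) \<le> d i"
    proof (rule ccontr)
      assume neg: "\<not> ?thesis"
      then have "dshift (d i) (- \<epsilon>) \<le> dshift (d' j) (- 2 * \<epsilon>)"
        by (simp add: dshift_le_iff not_le) (meson less_imp_le dshift_less_iff)
      with nontriv have "b' j < dshift (d' j) (- 2 * \<epsilon>)"
        by (rule less_le_trans)
      then obtain i' where "(i', j) \<in> C" "dshift (d' j) (- \<epsilon>) \<le> d i'"
        using col[OF j] by blast
      moreover from this(1) have "i' = i"
        using sv(2) \<open>(i, j) \<in> C\<close> by (auto dest: single_valuedD)
      ultimately show False
        using neg by simp
    qed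
    \<comment> \<open>Likewise, a failure would put the birth of bar \<open>i\<close> below its
      death shifted down by 2\<epsilon>, so \<open>row\<close> would apply to bar \<open>i\<close>,
      and row \<open>i\<close> contains only one pivot.\<close>
    have 4: "dshift (b' j) (- \<epsilon>) \<le> b i"
    proof (rule ccontr)
      assume neg: "\<not> ?thesis"
      then have "b i < dshift (b' j) (- \<epsilon>)"
        by (rule not_le_imp_less)
      also have "dshift (b' j) (- \<epsilon>) < dshift (d i) (- 2 * \<epsilon>)"
        using nontriv by (simp add: dshift_less_iff)
      finally have "b i < dshift (d i) (- 2 * \<epsilon>)" .
      then obtain j' where "(i, j') \<in> C" "dshift (b' j') (- \<epsilon>) \<le> b i"
        using row[OF i] by blast
      moreover from this(1) have "j' = j"
        using sv(1) \<open>(i, j) \<in> C\<close> by (auto dest: single_valuedD)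
      ultimately show False
        using neg by simp
    qed
    show ?thesis
      using 1 2 3 4 by (intro conjI bar_mono) (simp_all add: dshift_le_iff)
  qed
  ultimately have "eps_matching \<epsilon> I b d J b' d' ?M"
    unfolding eps_matching_def by blast
  then show ?thesis
    using col_pivots_eq_row_pivots[OF dist, of X] by (simp add: C_def)
qed

end
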